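(* Let $k\ge1$ be an integer, $H\in\mathbb{F}_q[x]$ nonzero, and $D_1,D_2$ monic divisors of $H$. Then $$\sum_{D\mid H}\eta_k\!\left(\Big(\frac{H}{D}\Big)^k,D_1\right)\eta_k\!\left(\Big(\frac{H}{D_2}\Big)^k,D\right)=\begin{cases}|H|^k,& D_1=D_2,\\ 0,&\text{otherwise},\end{cases}$$ where the sum is over the monic divisors $D$ of $H$.
   Context: Let $\mathbb{F}_q$ be a finite field with $q$ elements and fix a non-trivial homomorphism $\lambda:(\mathbb{F}_q,+)\to\mathbb{C}^*$. For nonzero $M\in\mathbb{F}_q[x]$ of degree $m\ge1$ and $A\in\mathbb{F}_q[x]$, let $t_M(A)$ be the coefficient of $x^{m-1}$ in the remainder of $A$ on division by $M$ (if $m=0$, $t_M(A)=0$), and $E(G,M)(A)=\lambda(t_M(GA))$. For $A,B$ not both zero, $(A,B)_k$ is the monic polynomial of the form $C^k$ of largest degree dividing both $A$ and $B$. For nonzero $D$, $\eta_k(G,D)=\sum_{R}E(G,D^k)(R)$, where $R$ runs over a complete residue system modulo $D^k$ with $(R,D^k)_k=1$. $|A|=q^{\deg A}$. *)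

theory Defs
  imports Complex_Main "HOL-Computational_Algebra.Polynomial"
    "HOL-Library.Cardinality" "HOL-Number_Theory.Cong"
begin

definition top_rem_coeff :: "'a::field poly \<Rightarrow> 'a poly \<Rightarrow> 'a" where
  "top_rem_coeff M A = (if degree M = 0 then 0 else coeff (A mod M) (degree M - 1))"

definition add_char ::
    "('a::field \<Rightarrow> complex) \<Rightarrow> 'a poly \<Rightarrow> 'a poly \<Rightarrow> 'a poly \<Rightarrow> complex" where
  "add_char \<psi> G M A = \<psi> (top_rem_coeff M (G * A))"

definition is_kgcd :: "nat \<Rightarrow> 'a::field poly \<Rightarrow> 'a poly \<Rightarrow> 'a poly \<Rightarrow> bool" where
  "is_kgcd k A B P \<longleftrightarrow>
     lead_coeff P = 1 \<and> (\<exists>C. P = C ^ k) \<and> P dvd A \<and> P dvd B \<and>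
     (\<forall>C. lead_coeff (C ^ k) = 1 \<and> C ^ k dvd A \<and> C ^ k dvd B \<longrightarrow> degree (C ^ k) \<le> degree P)"

text \<open>\<open>is_kgcd k A B P\<close> has exactly one solution \<open>P\<close> unless \<open>A = B = 0\<close>; see \<open>is_kgcd_exists\<close>
  and \<open>is_kgcd_unique\<close>.\<close>

definition kgcd :: "nat \<Rightarrow> 'a::field poly \<Rightarrow> 'a poly \<Rightarrow> 'a poly" where
  "kgcd k A B = (THE P. is_kgcd k A B P)"

text \<open>The sum over a complete residue system modulo \<open>D ^ k\<close> is taken over the remainders
  modulo \<open>D ^ k\<close>; by lemma \<open>eta_complete_residue_system\<close> below, any other
  complete residue system gives the same value.\<close>

definition eta ::
    "('a::field \<Rightarrow> complex) \<Rightarrow> nat \<Rightarrow> 'a poly \<Rightarrow> 'a poly \<Rightarrow> complex" where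
  "eta \<psi> k G D =
     (\<Sum>R | R \<in> range (\<lambda>A. A mod D ^ k) \<and> kgcd k R (D ^ k) = 1. add_char \<psi> G (D ^ k) R)"

definition poly_abs :: "'a::{finite,field} poly \<Rightarrow> nat" where
  "poly_abs A = (if A = 0 then 0 else CARD('a) ^ degree A)"

definition complete_residue_system :: "'a::field poly \<Rightarrow> 'a poly set \<Rightarrow> bool" where
  "complete_residue_system M S \<longleftrightarrow> (\<forall>A. \<exists>!R. R \<in> S \<and> [R = A] (mod M))"

lemma poly_bezout:
  fixes A B :: "'a::field poly"
  shows "\<exists>G a b u v. A = G * a \<and> B = G * b \<and> u * A + v * B = G"
proof (induction "if B = 0 then 0 else Suc (degree B)" arbitrary: A B rule: less_induct)
  case less
  show ?case
  proof (cases "B = 0")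
    case True
    then have "A = A * 1 \<and> B = A * 0 \<and> 1 * A + 0 * B = A" by simp
    then show ?thesis by blast
  next
    case False
    then have "A mod B = 0 \<or> degree (A mod B) < degree B" by (rule degree_mod_less)
    with False have "(if A mod B = 0 then 0 else Suc (degree (A mod B)))
        < (if B = 0 then 0 else Suc (degree B))" by auto
    from less[OF this, of B] obtain G a b u v where
      *: "B = G * a" "A mod B = G * b" "u * B + v * (A mod B) = G" by blast
    have A: "A = (A div B) * B + A mod B" by simp
    have "A = G * ((A div B) * a + b)"
    proof -
      have "G * ((A div B) * a + b) = (A div B) * (G * a) + G * b" by (simp add: algebra_simps)
      then show ?thesis using A unfolding *(1)[symmetric] *(2)[symmetric] by simp
    qed
    moreover have "v * A + (u - v * (A div B)) * B = G"
    proof -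
      have "v * A + (u - v * (A div B)) * B = u * B + v * (A - (A div B) * B)"
        by (simp add: algebra_simps)
      also have "A - (A div B) * B = A mod B" by (simp add: minus_div_mult_eq_mod)
      finally show ?thesis using *(3) by simp
    qed
    ultimately show ?thesis using *(1) by blast
  qed
qed

lemma is_kgcd_exists:
  fixes A B :: "'a::field poly"
  assumes "A \<noteq> 0 \<or> B \<noteq> 0"
  shows "\<exists>P. is_kgcd k A B P"
proof -
  let ?Q = "\<lambda>C. lead_coeff (C ^ k) = 1 \<and> C ^ k dvd A \<and> C ^ k dvd B"
  have "?Q 1" by simp
  moreover have "\<forall>C. ?Q C \<longrightarrow> degree (C ^ k) < Suc (degree A + degree B)"
    using assms by (auto dest!: dvd_imp_degree_le)
  ultimately obtain C where "?Q C" "\<forall>C'. ?Q C' \<longrightarrow> degree (C' ^ k) \<le> degree (C ^ k)"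
    using ex_has_greatest_nat[of ?Q 1 "\<lambda>C. degree (C ^ k)" "Suc (degree A + degree B)"]
    by blast
  then show ?thesis unfolding is_kgcd_def by blast
qed

lemma is_kgcd_unique:
  fixes A B :: "'a::field poly"
  assumes nz: "A \<noteq> 0 \<or> B \<noteq> 0" and P: "is_kgcd k A B P" and Q: "is_kgcd k A B Q"
  shows "P = Q"
proof -
  obtain C D where C: "P = C ^ k" and D: "Q = D ^ k"
    using P Q unfolding is_kgcd_def by blast
  obtain G c d u v where G: "C = G * c" "D = G * d" "u * C + v * D = G"
    using poly_bezout by blast
  show ?thesis
  proof (cases "k = 0 \<or> G = 0")
    case True
    then show ?thesis using C D G by auto
  next
    case False
    have "G * (u * c + v * d) = G * 1" using G by (simp add: algebra_simps)
    then have uv: "u * c + v * d = 1" using False by (metis mult_cancel_left)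
    have nzP: "P \<noteq> 0" "Q \<noteq> 0" using P Q unfolding is_kgcd_def by auto
    have nzk: "G ^ k \<noteq> 0" "c ^ k \<noteq> 0" "d ^ k \<noteq> 0"
      using nzP C D G by (auto simp: power_mult_distrib)
    define L where "L = (G * c * d) ^ k"
    have Ldvd: "L dvd X" if PX: "P dvd X" and QX: "Q dvd X" for X
    proof -
      obtain x where x: "X = G ^ k * c ^ k * x"
        using PX unfolding C G(1) power_mult_distrib dvd_def by blast
      obtain y where y: "X = G ^ k * d ^ k * y"
        using QX unfolding D G(2) power_mult_distrib dvd_def by blast
      have cd: "c ^ k * x = d ^ k * y" using x y nzk(1) by (auto simp: mult.assoc)
      have "\<exists>a b. a * c ^ k + b * d ^ k = 1"
      proof -
        have 1: "\<exists>a b. a * c ^ n + b * d = 1" for n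
        proof (induction n)
          case 0 show ?case by (rule exI[of _ 1], rule exI[of _ 0]) simp
        next
          case (Suc n)
          then obtain a b where ab: "a * c ^ n + b * d = 1" by blast
          have "1 = (a * c ^ n + b * d) * (u * c + v * d)" using ab uv by simp
          also have "\<dots> = (a * u) * c ^ Suc n + (a * c ^ n * v + b * u * c + b * v * d) * d"
            by (simp add: algebra_simps)
          finally show ?case by (intro exI) (rule sym)
        qed
        obtain a b where ab: "a * c ^ k + b * d = 1" using 1 by blast
        have "\<exists>a b. a * c ^ k + b * d ^ n = 1" for n
        proof (induction n)
          case 0 show ?case by (rule exI[of _ 0], rule exI[of _ 1]) simp
        next
          case (Suc n)
          then obtain a' b' where ab': "a' * c ^ k + b' * d ^ n = 1" by blast
          have "1 = (a' * c ^ k + b' * d ^ n) * (a * c ^ k + b * d)" using ab ab' by simp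
          also have "\<dots> = (a' * a * c ^ k + a' * b * d + b' * d ^ n * a) * c ^ k
              + (b' * b) * d ^ Suc n"
            by (simp add: algebra_simps)
          finally show ?case by (intro exI) (rule sym)
        qed
        then show ?thesis by blast
      qed
      then obtain a b where ab: "a * c ^ k + b * d ^ k = 1" by blast
      have "x = (a * c ^ k + b * d ^ k) * x" using ab by simp
      also have "\<dots> = a * (c ^ k * x) + b * d ^ k * x" by (simp add: algebra_simps)
      also have "\<dots> = d ^ k * (a * y + b * x)"
        by (subst cd) (simp add: algebra_simps)
      finally have "d ^ k dvd x" by (rule dvdI)
      then show ?thesis unfolding x L_def power_mult_distrib by (intro mult_dvd_mono dvd_refl)
    qed
    have mon: "lead_coeff G ^ k * lead_coeff c ^ k = 1" "lead_coeff G ^ k * lead_coeff d ^ k = 1"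
      using P Q C D G unfolding is_kgcd_def
      by (auto simp: lead_coeff_power lead_coeff_mult power_mult_distrib)
    define e where "e = [:inverse (lead_coeff d):]"
    have nzlc: "lead_coeff d \<noteq> 0" "lead_coeff c \<noteq> 0"
      using nzk False by (auto simp: power_eq_0_iff)
    define M where "M = G * c * d * e"
    have unit: "L dvd X \<Longrightarrow> M ^ k dvd X" for X
    proof -
      assume "L dvd X"
      moreover have "e * [:lead_coeff d:] = 1" using nzlc by (simp add: e_def one_pCons)
      then have "M * [:lead_coeff d:] = G * c * d" by (simp only: M_def mult.assoc mult_1_right)
      then have "L = M ^ k * [:lead_coeff d:] ^ k"
        unfolding L_def power_mult_distrib[symmetric] by simp
      ultimately show "M ^ k dvd X" using dvd_mult_left by blast
    qed
    have lcM: "lead_coeff (M ^ k) = 1"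
      using mon nzlc unfolding M_def e_def
      by (simp add: lead_coeff_power lead_coeff_mult power_mult_distrib field_simps)
    have dvds: "M ^ k dvd A" "M ^ k dvd B"
      using P Q unit Ldvd unfolding is_kgcd_def by blast+
    have nzs: "G \<noteq> 0" "c \<noteq> 0" "d \<noteq> 0" using False nzlc by auto
    have enz: "e \<noteq> 0" "degree e = 0" using nzlc by (auto simp: e_def)
    have "degree (M ^ k) \<le> degree P" "degree (M ^ k) \<le> degree Q"
      using P Q lcM dvds unfolding is_kgcd_def by blast+
    then have "degree d = 0" "degree c = 0"
      using nzs enz False unfolding M_def C D G(1,2)
      by (auto simp: degree_power_eq degree_mult_eq)
    then obtain c0 d0 where "c = [:c0:]" "d = [:d0:]" by (metis degree_eq_zeroE)
    then have "c0 ^ k = d0 ^ k" using mon by (metis lead_coeff_pCons(2) mult_cancel_left mult_zero_left zero_neq_one)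
    then have "c ^ k = d ^ k" using \<open>c = _\<close> \<open>d = _\<close> by (simp add: poly_const_pow)
    then show ?thesis using C D G by (simp add: power_mult_distrib)
  qed
qed

lemma is_kgcd_kgcd:
  fixes A B :: "'a::field poly"
  assumes "A \<noteq> 0 \<or> B \<noteq> 0"
  shows "is_kgcd k A B (kgcd k A B)"
  unfolding kgcd_def by (rule theI') (use is_kgcd_exists[OF assms] is_kgcd_unique[OF assms] in blast)

lemma eta_complete_residue_system:
  fixes D :: "'a::field poly"
  assumes S: "complete_residue_system (D ^ k) S"
  shows "eta \<psi> k G D = (\<Sum>R | R \<in> S \<and> kgcd k R (D ^ k) = 1. add_char \<psi> G (D ^ k) R)"
proof -
  let ?M = "D ^ k"
  have kg: "kgcd k (R mod ?M) ?M = kgcd k R ?M" for R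
  proof -
    have "P dvd R mod ?M \<longleftrightarrow> P dvd R" if "P dvd ?M" for P
      using that by (rule dvd_mod_iff)
    then have "is_kgcd k (R mod ?M) ?M = is_kgcd k R ?M"
      unfolding is_kgcd_def fun_eq_iff by blast
    then show ?thesis by (simp add: kgcd_def)
  qed
  have ch: "add_char \<psi> G ?M (R mod ?M) = add_char \<psi> G ?M R" for R
    by (simp add: add_char_def top_rem_coeff_def mod_mult_right_eq)
  have inj: "R = R'" if "R \<in> S" "R' \<in> S" "R mod ?M = R' mod ?M" for R R'
    using S that unfolding complete_residue_system_def cong_def by metis
  have ex: "\<exists>R\<in>S. R mod ?M = A mod ?M" for A
    using S unfolding complete_residue_system_def cong_def by metis
  have "bij_betw (\<lambda>R. R mod ?M) {R. R \<in> S \<and> kgcd k R ?M = 1}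
      {R. R \<in> range (\<lambda>A. A mod ?M) \<and> kgcd k R ?M = 1}"
    unfolding bij_betw_def
  proof (intro conjI inj_onI set_eqI iffI)
    fix R assume "R \<in> {R. R \<in> range (\<lambda>A. A mod ?M) \<and> kgcd k R ?M = 1}"
    then obtain A where "R = A mod ?M" "kgcd k R ?M = 1" by blast
    moreover obtain R' where "R' \<in> S" "R' mod ?M = A mod ?M" using ex by blast
    ultimately show "R \<in> (\<lambda>R. R mod ?M) ` {R. R \<in> S \<and> kgcd k R ?M = 1}"
      using kg[of R'] by (intro image_eqI[of _ _ R']) auto
  qed (auto simp: kg intro: inj)
  then have "(\<Sum>R | R \<in> S \<and> kgcd k R ?M = 1. add_char \<psi> G ?M (R mod ?M)) = eta \<psi> k G D"
    unfolding eta_def by (rule sum.reindex_bij_betw)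
  then show ?thesis by (simp add: ch)
qed

end

theory Submission
  imports Defs
begin

text \<open>The residues modulo \<open>D ^ k\<close> split according to their \<open>k\<close>-th power gcd with \<open>D ^ k\<close>, which gives
  \<open>\<Sum>d | D. \<eta>(G, d) = |D| ^ k\<close> if \<open>D ^ k\<close> divides \<open>G\<close> and \<open>0\<close> otherwise. Let \<open>T(D1)\<close> be the sum of the
  theorem. Applying this identity first to the factor \<open>\<eta>((H / D) ^ k, d)\<close> and then to the remaining sum
  over \<open>D | H / D1\<close> yields \<open>\<Sum>d | D1. T(d) = |H| ^ k\<close> if \<open>D2\<close> divides \<open>D1\<close> and \<open>0\<close> otherwise, and these
  divisor sums determine \<open>T\<close>.\<close>

section \<open>Divisibility of powers of polynomials\<close>

text \<open>Multiplying the relation for \<open>n\<close> by the original one leaves a single term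
  without the factor \<open>a\<close>, and that term contains \<open>b ^ Suc n\<close>.\<close>

lemma bezout_power:
  fixes a b u v :: "'a::comm_ring_1"
  assumes "u * a + v * b = 1"
  shows "\<exists>u' v'. u' * a + v' * b ^ n = 1"
proof (induction n)
  case 0
  have "0 * a + 1 * b ^ 0 = 1" by simp
  then show ?case by blast
next
  case (Suc n)
  then obtain x y where xy: "x * a + y * b ^ n = 1" by blast
  have "1 = (x * a + y * b ^ n) * (u * a + v * b)" using assms xy by simp
  also have "\<dots> = (x * u * a + x * v * b + y * b ^ n * u) * a + (y * v) * b ^ Suc n"
    by (simp add: algebra_simps)
  finally show ?case by (intro exI) (rule sym)
qed

lemma bezout_power_power:
  fixes a b u v :: "'a::comm_ring_1"
  assumes "u * a + v * b = 1"
  shows "\<exists>u' v'. u' * a ^ n + v' * b ^ n = 1"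
proof -
  obtain x y where "x * a + y * b ^ n = 1" using bezout_power[OF assms] by blast
  then have "y * b ^ n + x * a = 1" by (simp add: add.commute)
  from bezout_power[OF this, of n] show ?thesis by (metis add.commute)
qed

lemma bezout_dvd_mult:
  fixes a b u v x :: "'a::comm_ring_1"
  assumes "u * a + v * b = 1" and "a dvd b * x"
  shows "a dvd x"
proof -
  have "x = (u * a + v * b) * x" using assms by simp
  also have "\<dots> = a * (u * x) + v * (b * x)" by (simp add: algebra_simps)
  also have "a dvd \<dots>" by (intro dvd_add dvd_triv_left dvd_mult assms(2))
  finally show ?thesis .
qed

text \<open>Cancelling the nonzero common factor in a Bezout relation leaves coprime cofactors with
  explicit coefficients. This carries the divisibility arguments below without factorization into
  irreducibles.\<close>

lemma poly_gcd_cofactors: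
  fixes A B :: "'a::field poly"
  assumes "A \<noteq> 0"
  obtains G a b u v where "A = G * a" "B = G * b" "u * a + v * b = 1" "G \<noteq> 0"
proof -
  obtain G a b u v where *: "A = G * a" "B = G * b" "u * A + v * B = G"
    using poly_bezout by blast
  have "G \<noteq> 0" using assms * by auto
  moreover have "G * (u * a + v * b) = G * 1" using * by (simp add: algebra_simps)
  ultimately have "u * a + v * b = 1" by (metis mult_cancel_left)
  then show ?thesis using that * \<open>G \<noteq> 0\<close> by blast
qed

text \<open>Once the common factor is cancelled, \<open>a ^ k\<close> and \<open>b ^ k\<close> are
  still coprime, so \<open>a ^ k dvd b ^ k\<close> makes \<open>a\<close> a unit.\<close>

lemma poly_power_dvd_power_iff:
  fixes A B :: "'a::field poly"
  assumes "A \<noteq> 0" and "k \<ge> 1"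
  shows "A ^ k dvd B ^ k \<longleftrightarrow> A dvd B"
proof
  assume dvd: "A ^ k dvd B ^ k"
  obtain G a b u v where *: "A = G * a" "B = G * b" "u * a + v * b = 1" "G \<noteq> 0"
    using poly_gcd_cofactors[OF assms(1)] by blast
  obtain x y where xy: "x * a ^ k + y * b ^ k = 1" using bezout_power_power[OF *(3)] by blast
  have "a ^ k dvd b ^ k * 1" using dvd * by (simp add: power_mult_distrib)
  then have "a ^ k dvd 1" by (rule bezout_dvd_mult[OF xy])
  then have "a dvd 1" using assms(2) by (metis is_unit_power_iff not_one_le_zero)
  then have "a dvd b" by (metis dvd_trans one_dvd)
  then show "A dvd B" unfolding * by (rule mult_dvd_mono[OF dvd_refl])
qed (rule dvd_power_same)

lemma monic_degree_0_iff: "lead_coeff C = 1 \<Longrightarrow> degree C = 0 \<longleftrightarrow> C = 1"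
  by (metis degree_1 degree_eq_zeroE lead_coeff_pCons(2) one_pCons)

lemma monic_dvd_antisym:
  fixes C D :: "'a::field poly"
  assumes "lead_coeff C = 1" "lead_coeff D = 1" "C dvd D" "D dvd C"
  shows "C = D"
proof -
  obtain E where E: "D = C * E" using assms by blast
  have "degree D \<le> degree C" "C \<noteq> 0" "D \<noteq> 0" "E \<noteq> 0" using assms E by (auto intro: dvd_imp_degree_le)
  then have "degree E = 0" using E by (simp add: degree_mult_eq)
  moreover have "lead_coeff E = 1" using assms E by (simp add: lead_coeff_mult)
  ultimately show ?thesis using E monic_degree_0_iff by fastforce
qed

lemma monic_associate:
  fixes C :: "'a::field poly"
  assumes "C \<noteq> 0"
  obtains C' where "lead_coeff C' = 1" "degree C' = degree C" "C' dvd C" "C dvd C'"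
proof
  let ?C = "smult (inverse (lead_coeff C)) C"
  show "lead_coeff ?C = 1" "degree ?C = degree C" using assms by auto
  show "?C dvd C" "C dvd ?C" using assms by (auto simp: smult_dvd_iff dvd_smult)
qed

section \<open>The coprimality condition\<close>

text \<open>Replaces the maximality in \<open>kgcd\<close> by a test on monic divisors of
  \<open>D\<close> itself, the form in which the condition is used below.\<close>

lemma kgcd_eq_1_iff:
  fixes D R :: "'a::field poly"
  assumes D: "D \<noteq> 0" and k: "k \<ge> 1"
  shows "kgcd k R (D ^ k) = 1 \<longleftrightarrow>
    (\<forall>C. lead_coeff C = 1 \<and> C dvd D \<and> C ^ k dvd R \<longrightarrow> C = 1)" (is "_ \<longleftrightarrow> ?rhs")
proof
  assume 1: "kgcd k R (D ^ k) = 1"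
  have kg: "is_kgcd k R (D ^ k) 1" using is_kgcd_kgcd[of R "D ^ k" k] D 1 by simp
  show ?rhs
  proof (intro allI impI)
    fix C assume C: "lead_coeff C = 1 \<and> C dvd D \<and> C ^ k dvd R"
    then have "C ^ k dvd D ^ k" "lead_coeff (C ^ k) = 1"
      by (auto intro: dvd_power_same simp: lead_coeff_power)
    with kg C have "degree (C ^ k) \<le> 0" unfolding is_kgcd_def by (metis degree_1)
    moreover have "C \<noteq> 0" using C by auto
    ultimately have "degree C = 0" using k by (simp add: degree_power_eq)
    then show "C = 1" using C monic_degree_0_iff by blast
  qed
next
  assume rhs: ?rhs
  have "degree (C ^ k) = 0" if C: "lead_coeff (C ^ k) = 1" "C ^ k dvd R" "C ^ k dvd D ^ k" for C
  proof -
    have nz: "C \<noteq> 0" using C k by (auto simp: power_0_left)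
    \<comment> \<open>Only \<open>C ^ k\<close> is known to be monic, while the hypothesis speaks of
      monic \<open>C\<close>.\<close>
    obtain C' where C': "lead_coeff C' = 1" "degree C' = degree C" "C' dvd C"
      using monic_associate[OF nz] by blast
    have "C dvd D" using C(3) nz k by (simp add: poly_power_dvd_power_iff)
    with C'(3) have "C' dvd D" by (rule dvd_trans)
    moreover have "C' ^ k dvd R" using dvd_power_same[OF C'(3)] C(2) by (rule dvd_trans)
    ultimately have "C' = 1" using rhs C' by blast
    then show ?thesis using C' nz by (simp add: degree_power_eq)
  qed
  then have "is_kgcd k R (D ^ k) 1"
    unfolding is_kgcd_def by (auto intro: exI[of _ 1])
  then show "kgcd k R (D ^ k) = 1"
    using is_kgcd_unique is_kgcd_kgcd D by (metis power_not_zero)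
qed

text \<open>After splitting off the common factor of \<open>E\<close> and \<open>C\<close>, the rest
  \<open>a\<close> of \<open>E\<close> divides \<open>d\<close> and \<open>a ^ k\<close> divides
  \<open>R\<close>, so the condition on \<open>R\<close> makes \<open>a\<close> a unit. This yields
  injectivity in \<open>residues_decomposition\<close>.\<close>

lemma power_dvd_mult_kgcd_1:
  fixes C d E R :: "'a::field poly"
  assumes k: "k \<ge> 1" and E: "E \<noteq> 0" and d: "d \<noteq> 0"
    and R: "kgcd k R (d ^ k) = 1"
    and dvds: "E dvd C * d" "E ^ k dvd C ^ k * R"
  shows "E dvd C"
proof -
  obtain G a b u v where *: "E = G * a" "C = G * b" "u * a + v * b = 1" "G \<noteq> 0"
    using poly_gcd_cofactors[OF E] by blast
  obtain x y where xy: "x * a ^ k + y * b ^ k = 1" using bezout_power_power[OF *(3)] by blast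
  have "a dvd b * d" using dvds(1) * by (simp add: mult.assoc)
  then have ad: "a dvd d" by (rule bezout_dvd_mult[OF *(3)])
  have "a ^ k dvd b ^ k * R" using dvds(2) * by (simp add: power_mult_distrib mult.assoc)
  then have aR: "a ^ k dvd R" by (rule bezout_dvd_mult[OF xy])
  have "a \<noteq> 0" using E * by auto
  then obtain a' where a': "lead_coeff a' = 1" "a' dvd a" "a dvd a'" using monic_associate by blast
  have "a' dvd d" using a'(2) ad by (rule dvd_trans)
  moreover have "a' ^ k dvd R" using dvd_power_same[OF a'(2)] aR by (rule dvd_trans)
  ultimately have "a' = 1" using R a'(1) unfolding kgcd_eq_1_iff[OF d k] by blast
  then have "a dvd b" using a'(3) by (metis dvd_trans one_dvd)
  then show ?thesis using * by simp
qed

section \<open>Complete character sums\<close>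

text \<open>The coefficient form treats the zero remainder and constant \<open>M\<close> uniformly
  and can be counted by induction on the degree bound.\<close>

lemma residues_eq:
  fixes M :: "'a::field poly"
  assumes "M \<noteq> 0"
  shows "range (\<lambda>A. A mod M) = {p. \<forall>i\<ge>degree M. coeff p i = 0}"
proof (intro set_eqI iffI)
  fix p assume "p \<in> range (\<lambda>A. A mod M)"
  then obtain A where p: "p = A mod M" by blast
  then have "p = 0 \<or> degree p < degree M" using assms degree_mod_less by blast
  then show "p \<in> {p. \<forall>i\<ge>degree M. coeff p i = 0}" by (auto intro: coeff_eq_0)
next
  fix p :: "'a poly" assume p: "p \<in> {p. \<forall>i\<ge>degree M. coeff p i = 0}"
  then have "p = 0 \<or> degree p < degree M"
    using leading_coeff_0_iff[of p] linorder_not_le[of "degree M" "degree p"] by blast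
  then have "p = p mod M" by (auto simp: mod_poly_less)
  then show "p \<in> range (\<lambda>A. A mod M)" by blast
qed

lemma poly_coeffs_below:
  "finite {p :: 'a::{finite,field} poly. \<forall>i\<ge>n. coeff p i = 0} \<and>
   card {p :: 'a poly. \<forall>i\<ge>n. coeff p i = 0} = CARD('a) ^ n"
proof (induction n)
  case 0
  have "{p :: 'a poly. \<forall>i\<ge>0. coeff p i = 0} = {0}" by (auto simp: poly_eq_iff)
  then show ?case by simp
next
  case (Suc n)
  let ?P = "\<lambda>n. {p :: 'a poly. \<forall>i\<ge>n. coeff p i = 0}"
  have "?P (Suc n) = (\<lambda>(a, p). pCons a p) ` (UNIV \<times> ?P n)"
  proof (intro set_eqI iffI)
    fix p assume p: "p \<in> ?P (Suc n)"
    obtain a q where q: "p = pCons a q" by (cases p)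
    have "coeff q i = 0" if "i \<ge> n" for i
      using p that q by (metis (mono_tags, lifting) Suc_le_mono coeff_pCons_Suc mem_Collect_eq)
    then show "p \<in> (\<lambda>(a, p). pCons a p) ` (UNIV \<times> ?P n)" using q by auto
  next
    fix p assume "p \<in> (\<lambda>(a, p). pCons a p) ` (UNIV \<times> ?P n)"
    then show "p \<in> ?P (Suc n)" by (auto simp: coeff_pCons split: nat.split)
  qed
  moreover have "inj_on (\<lambda>(a, p). pCons a p) (UNIV \<times> ?P n)" by (auto simp: inj_on_def)
  ultimately show ?case using Suc by (simp add: card_image card_cartesian_product)
qed

lemma finite_residues: "M \<noteq> 0 \<Longrightarrow> finite (range (\<lambda>A. A mod (M :: 'a::{finite,field} poly)))"
  using residues_eq[of M] poly_coeffs_below[where ?'a = 'a and n = "degree M"]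
  by simp

lemma card_residues:
  "M \<noteq> 0 \<Longrightarrow> card (range (\<lambda>A. A mod (M :: 'a::{finite,field} poly))) = poly_abs M"
  using residues_eq[of M] poly_coeffs_below[where ?'a = 'a and n = "degree M"]
  by (simp add: poly_abs_def)

lemma finite_monic_divisors:
  fixes H :: "'a::{finite,field} poly"
  assumes "H \<noteq> 0"
  shows "finite {D. lead_coeff D = 1 \<and> D dvd H}"
proof (rule finite_subset)
  show "{D. lead_coeff D = 1 \<and> D dvd H} \<subseteq> {p. \<forall>i\<ge>Suc (degree H). coeff p i = 0}"
    using assms by (auto intro!: coeff_eq_0 dest!: dvd_imp_degree_le)
qed (simp add: poly_coeffs_below)

section \<open>The coefficient functional and the orthogonality of characters\<close>

lemma top_rem_coeff_eq:
  "M \<noteq> 0 \<Longrightarrow> top_rem_coeff M A = coeff (A mod M) (degree M - 1)"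
  \<comment> \<open>For \<open>degree M = 0\<close> the remainder is 0, so the truncated index
    \<open>0 - 1\<close> reads the value 0 that the definition prescribes.\<close>
  using degree_mod_less[of M A] by (auto simp: top_rem_coeff_def)

lemma top_rem_coeff_mod: "top_rem_coeff M (G * (R mod M)) = top_rem_coeff M (G * R)"
  by (simp add: top_rem_coeff_def mod_mult_right_eq)

lemma top_rem_coeff_add: "top_rem_coeff M (A + B) = top_rem_coeff M A + top_rem_coeff M B"
  by (simp add: top_rem_coeff_def poly_mod_add_left)

text \<open>The remainder is multiplied by \<open>C\<close>, and a monic factor shifts the
  coefficient at \<open>degree M - 1\<close> up by \<open>degree C\<close> unchanged; for constant
  \<open>M\<close> both sides vanish. Characters with different moduli \<open>d ^ k\<close> thereby
  become comparable.\<close>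

lemma top_rem_coeff_mult_monic:
  fixes C M A :: "'a::field poly"
  assumes "lead_coeff C = 1" and "M \<noteq> 0"
  shows "top_rem_coeff (C * M) (C * A) = top_rem_coeff M A"
proof (cases "degree M = 0")
  case True
  then have "A mod M = 0" using assms(2) degree_mod_less[of M A] by auto
  moreover have "C * M \<noteq> 0" using assms by auto
  ultimately show ?thesis using assms by (simp add: top_rem_coeff_eq mod_mult_mult1)
next
  case False
  have nz: "C \<noteq> 0" using assms by auto
  have deg: "degree (A mod M) \<le> degree M - 1"
    using degree_mod_less[of M A] assms(2) False by auto
  have "coeff (C * (A mod M)) (degree C + (degree M - 1)) = coeff (A mod M) (degree M - 1)"
  proof (cases "degree (A mod M) = degree M - 1")
    case True
    then show ?thesis using assms(1) by (metis coeff_mult_degree_sum mult_1)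
  next
    case False
    then have *: "degree (A mod M) < degree M - 1" using deg by simp
    then have "degree (C * (A mod M)) < degree C + (degree M - 1)"
      by (meson add_strict_left_mono degree_mult_le le_less_trans)
    then show ?thesis using * by (simp add: coeff_eq_0)
  qed
  then show ?thesis using assms nz False
    by (simp add: top_rem_coeff_eq mod_mult_mult1 degree_mult_eq)
qed

lemma top_rem_coeff_surj:
  fixes M G :: "'a::field poly"
  assumes M: "M \<noteq> 0" and G: "\<not> M dvd G"
  shows "\<exists>R. top_rem_coeff M (G * R) = x"
proof -
  define g where "g = G mod M"
  have g: "g \<noteq> 0" "degree g < degree M"
    using assms degree_mod_less[of M G] by (auto simp: g_def dvd_eq_mod_eq_0)
  \<comment> \<open>The monomial lifts the leading term of \<open>g\<close> to degree
    \<open>degree M - 1\<close> and scales it to \<open>x\<close>; the product stays below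
    \<open>degree M\<close>, hence is its own remainder.\<close>
  define R where "R = monom (x / lead_coeff g) (degree M - 1 - degree g)"
  have c: "coeff (g * R) (degree M - 1) = x"
    using g by (simp add: R_def mult.commute[of g] coeff_monom_mult)
  have "degree (g * R) \<le> degree g + (degree M - 1 - degree g)"
    unfolding R_def by (meson add_left_mono degree_monom_le degree_mult_le le_trans)
  then have "degree (g * R) < degree M" using g by linarith
  then have "(g * R) mod M = g * R" by (rule mod_poly_less)
  moreover have "(g * R) mod M = (G * R) mod M" by (simp add: g_def mod_mult_left_eq)
  ultimately show ?thesis using c M by (metis top_rem_coeff_eq)
qed

text \<open>If \<open>M\<close> does not divide \<open>G\<close>, translation by a suitable
  \<open>R0\<close> permutes the residues and multiplies the sum by some \<open>\<psi> x\<close>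
  other than 1, so the sum vanishes. Otherwise every summand is 1.\<close>

lemma complete_add_char_sum:
  fixes \<psi> :: "'a::{finite,field} \<Rightarrow> complex"
  assumes nz: "\<And>x. \<psi> x \<noteq> 0" and add: "\<And>x y. \<psi> (x + y) = \<psi> x * \<psi> y"
    and nontrivial: "\<exists>x. \<psi> x \<noteq> 1" and M: "M \<noteq> 0"
  shows "(\<Sum>R\<in>range (\<lambda>A. A mod M). add_char \<psi> G M R) = (if M dvd G then of_nat (poly_abs M) else 0)"
proof (cases "M dvd G")
  case True
  have "\<psi> 0 = 1" using add[of 0 0] nz[of 0] by simp
  then have "add_char \<psi> G M R = 1" for R
    using True M by (simp add: add_char_def top_rem_coeff_eq)
  then show ?thesis using True card_residues[OF M] by simp
next
  case False
  let ?S = "range (\<lambda>A. A mod M)"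
  obtain x where x: "\<psi> x \<noteq> 1" using nontrivial by blast
  obtain R0 where R0: "top_rem_coeff M (G * R0) = x" using top_rem_coeff_surj[OF M False] by blast
  have shift: "add_char \<psi> G M ((R + R0) mod M) = \<psi> x * add_char \<psi> G M R" for R
    by (simp add: add_char_def top_rem_coeff_mod distrib_left top_rem_coeff_add add R0 mult.commute)
  have "bij_betw (\<lambda>R. (R + R0) mod M) ?S ?S"
  proof (rule bij_betw_byWitness[where f' = "\<lambda>R. (R - R0) mod M"])
    show "\<forall>R\<in>?S. ((R + R0) mod M - R0) mod M = R" by (auto simp: mod_simps)
    show "\<forall>R\<in>?S. ((R - R0) mod M + R0) mod M = R" by (auto simp: mod_simps)
  qed auto
  then have "(\<Sum>R\<in>?S. add_char \<psi> G M ((R + R0) mod M)) = (\<Sum>R\<in>?S. add_char \<psi> G M R)"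
    by (rule sum.reindex_bij_betw)
  then have "\<psi> x * (\<Sum>R\<in>?S. add_char \<psi> G M R) = (\<Sum>R\<in>?S. add_char \<psi> G M R)"
    by (simp add: shift sum_distrib_left)
  then show ?thesis using x False by simp
qed

section \<open>Divisor sums of \<open>\<eta>\<close>\<close>

text \<open>A residue \<open>Q\<close> belongs to \<open>d = D div C\<close>, where \<open>C\<close>
  is a monic divisor of \<open>D\<close> of largest degree with \<open>C ^ k dvd Q\<close>; then
  \<open>R\<close> is \<open>Q\<close> divided by \<open>C ^ k\<close>.\<close>

lemma residues_decomposition:
  fixes D :: "'a::field poly"
  assumes D: "lead_coeff D = 1" and k: "k \<ge> 1"
  shows "bij_betw (\<lambda>(d, R). (D div d) ^ k * R)
    (SIGMA d:{d. lead_coeff d = 1 \<and> d dvd D}. {R. R \<in> range (\<lambda>A. A mod d ^ k) \<and> kgcd k R (d ^ k) = 1})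
    (range (\<lambda>A. A mod D ^ k))"
proof -
  have D0: "D \<noteq> 0" using D by auto
  have cofactor: "D = (D div d) * d" "lead_coeff (D div d) = 1" "d \<noteq> 0" "D div d \<noteq> 0"
    if "lead_coeff d = 1" "d dvd D" for d
  proof -
    show 1: "D = (D div d) * d" using that by simp
    have "lead_coeff (D div d) * lead_coeff d = 1" using 1 D by (metis lead_coeff_mult)
    then show "lead_coeff (D div d) = 1" using that by simp
    show "d \<noteq> 0" "D div d \<noteq> 0" using 1 D0 by auto
  qed
  \<comment> \<open>Used in both directions, this makes the monic cofactors of two pairs with the
    same image equal.\<close>
  have dvd: "D div e dvd D div d"
    if d: "lead_coeff d = 1" "d dvd D" and e: "lead_coeff e = 1" "e dvd D"
      and R: "kgcd k R (d ^ k) = 1" and eq: "(D div d) ^ k * R = (D div e) ^ k * S" for d e R S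
  proof (rule power_dvd_mult_kgcd_1[OF k _ _ R])
    show "D div e dvd D div d * d" using cofactor(1)[OF d] cofactor(1)[OF e] by (metis dvd_triv_left)
    show "(D div e) ^ k dvd (D div d) ^ k * R" unfolding eq by simp
  qed (use cofactor d e in auto)
  show ?thesis
    unfolding bij_betw_def
  proof (intro conjI inj_onI set_eqI iffI)
    fix p p'
    assume p: "p \<in> (SIGMA d:{d. lead_coeff d = 1 \<and> d dvd D}.
        {R. R \<in> range (\<lambda>A. A mod d ^ k) \<and> kgcd k R (d ^ k) = 1})"
      and p': "p' \<in> (SIGMA d:{d. lead_coeff d = 1 \<and> d dvd D}.
        {R. R \<in> range (\<lambda>A. A mod d ^ k) \<and> kgcd k R (d ^ k) = 1})"
      and eq: "(case p of (d, R) \<Rightarrow> (D div d) ^ k * R) = (case p' of (d, R) \<Rightarrow> (D div d) ^ k * R)"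
    obtain d R where dR: "p = (d, R)" by (cases p)
    obtain e S where eS: "p' = (e, S)" by (cases p')
    have d: "lead_coeff d = 1" "d dvd D" "kgcd k R (d ^ k) = 1" using p dR by auto
    have e: "lead_coeff e = 1" "e dvd D" "kgcd k S (e ^ k) = 1" using p' eS by auto
    have eq': "(D div d) ^ k * R = (D div e) ^ k * S" using eq dR eS by simp
    have same: "D div d = D div e"
      by (intro monic_dvd_antisym cofactor dvd[OF d(1,2) e(1,2) d(3) eq']
          dvd[OF e(1,2) d(1,2) e(3) eq'[symmetric]] d e)
    then have "R = S" using eq' cofactor(4)[OF e(1,2)] by simp
    moreover have "d = e"
      using same cofactor(1)[OF d(1,2)] cofactor(1,4)[OF e(1,2)] by (metis mult_cancel_left)
    ultimately show "p = p'" using dR eS by simp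
  next
    fix Q
    assume "Q \<in> (\<lambda>(d, R). (D div d) ^ k * R) ` (SIGMA d:{d. lead_coeff d = 1 \<and> d dvd D}.
        {R. R \<in> range (\<lambda>A. A mod d ^ k) \<and> kgcd k R (d ^ k) = 1})"
    then obtain d A where d: "lead_coeff d = 1" "d dvd D" and Q: "Q = (D div d) ^ k * (A mod d ^ k)"
      by auto
    have "Q = ((D div d) ^ k * A) mod ((D div d) ^ k * d ^ k)"
      unfolding Q by (rule mod_mult_mult1[symmetric])
    also have "(D div d) ^ k * d ^ k = D ^ k"
      using cofactor(1)[OF d] by (metis power_mult_distrib)
    finally show "Q \<in> range (\<lambda>A. A mod D ^ k)" by blast
  next
    fix Q assume "Q \<in> range (\<lambda>A. A mod D ^ k)"
    then obtain A where Q: "Q = A mod D ^ k" by blast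
    let ?P = "\<lambda>C. lead_coeff C = 1 \<and> C dvd D \<and> C ^ k dvd Q"
    have "?P 1" by simp
    moreover have "\<forall>C. ?P C \<longrightarrow> degree C < Suc (degree D)"
      using D0 by (auto dest!: dvd_imp_degree_le)
    ultimately obtain C where C: "?P C" and max: "\<forall>C'. ?P C' \<longrightarrow> degree C' \<le> degree C"
      using ex_has_greatest_nat[of ?P 1 degree "Suc (degree D)"] by blast
    obtain R where R: "Q = C ^ k * R" using C by blast
    obtain d where d: "D = C * d" using C by blast
    have C0: "C \<noteq> 0" "d \<noteq> 0" using D0 d by auto
    have ld: "lead_coeff d = 1" using D C d by (simp add: lead_coeff_mult)
    have Dd: "D div d = C" using d C0 by simp
    \<comment> \<open>\<open>Q\<close> is already reduced modulo
      \<open>D ^ k = C ^ k * d ^ k\<close>; cancelling \<open>C ^ k\<close> shows that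
      \<open>R\<close> is reduced modulo \<open>d ^ k\<close>.\<close>
    have "C ^ k * R = (C ^ k * R) mod (C ^ k * d ^ k)"
      using Q R d by (simp add: power_mult_distrib)
    also have "\<dots> = C ^ k * (R mod d ^ k)" by (rule mod_mult_mult1)
    finally have "R = R mod d ^ k" using C0 by simp
    then have "R \<in> range (\<lambda>A. A mod d ^ k)" by blast
    moreover have "kgcd k R (d ^ k) = 1"
      unfolding kgcd_eq_1_iff[OF C0(2) k]
    proof (intro allI impI)
      fix E assume E: "lead_coeff E = 1 \<and> E dvd d \<and> E ^ k dvd R"
      \<comment> \<open>\<open>C * E\<close> is another candidate, so the maximal degree of
        \<open>C\<close> leaves only degree 0 for \<open>E\<close>.\<close>
      then have "?P (C * E)"
        using C by (auto simp: lead_coeff_mult d R power_mult_distrib)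
      then have "degree (C * E) \<le> degree C" using max by blast
      moreover have "E \<noteq> 0" using E by auto
      ultimately have "degree E = 0" using C0 by (simp add: degree_mult_eq)
      then show "E = 1" using E monic_degree_0_iff by blast
    qed
    ultimately show "Q \<in> (\<lambda>(d, R). (D div d) ^ k * R) ` (SIGMA d:{d. lead_coeff d = 1 \<and> d dvd D}.
        {R. R \<in> range (\<lambda>A. A mod d ^ k) \<and> kgcd k R (d ^ k) = 1})"
      using Dd R d ld by (intro image_eqI[of _ _ "(d, R)"]) auto
  qed
qed

lemma poly_abs_mult: "poly_abs (A * B) = poly_abs A * poly_abs B"
  by (simp add: poly_abs_def degree_mult_eq power_add)

lemma poly_abs_power: "A \<noteq> 0 \<Longrightarrow> poly_abs (A ^ k) = poly_abs A ^ k"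
  by (simp add: poly_abs_def degree_power_eq power_mult[symmetric] mult.commute)

lemma eta_divisor_sum:
  fixes \<psi> :: "'a::{finite,field} \<Rightarrow> complex"
  assumes nz: "\<And>x. \<psi> x \<noteq> 0" and add: "\<And>x y. \<psi> (x + y) = \<psi> x * \<psi> y"
    and nontrivial: "\<exists>x. \<psi> x \<noteq> 1" and k: "k \<ge> 1" and D: "D \<noteq> 0"
  shows "(\<Sum>d | lead_coeff d = 1 \<and> d dvd D. eta \<psi> k G d)
    = (if D ^ k dvd G then of_nat (poly_abs D) ^ k else 0)"
proof -
  \<comment> \<open>\<open>D\<close> need not be monic, as for the later choice
    \<open>H div E\<close>. Its monic associate has the same divisors and absolute value, and all
    cofactors \<open>C div d\<close> are monic.\<close>
  obtain C where C: "lead_coeff C = 1" "degree C = degree D" "C dvd D" "D dvd C"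
    using monic_associate[OF D] by blast
  have C0: "C \<noteq> 0" using C by auto
  let ?d = "{d. lead_coeff d = 1 \<and> d dvd C}"
  let ?R = "\<lambda>d. {R. R \<in> range (\<lambda>A. A mod d ^ k) \<and> kgcd k R (d ^ k) = 1}"
  \<comment> \<open>Scaling argument and modulus by \<open>(C div d) ^ k\<close> brings all summands
    to the common modulus \<open>C ^ k\<close>.\<close>
  have char: "add_char \<psi> G (d ^ k) R = add_char \<psi> G (C ^ k) ((C div d) ^ k * R)"
    if "d \<in> ?d" for d R
  proof -
    have eq: "C = (C div d) * d" using that by simp
    have "lead_coeff (C div d) * lead_coeff d = 1" using C eq by (metis lead_coeff_mult)
    then have "lead_coeff ((C div d) ^ k) = 1" using that by (simp add: lead_coeff_power)
    moreover have "d ^ k \<noteq> 0" using that by auto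
    ultimately have "top_rem_coeff ((C div d) ^ k * d ^ k) ((C div d) ^ k * (G * R))
        = top_rem_coeff (d ^ k) (G * R)" by (rule top_rem_coeff_mult_monic)
    moreover have "(C div d) ^ k * d ^ k = C ^ k" using eq by (metis power_mult_distrib)
    ultimately show ?thesis by (simp add: add_char_def mult.left_commute)
  qed
  have fin: "finite ?d" using finite_monic_divisors[OF C0] .
  have finR: "\<forall>d\<in>?d. finite (?R d)"
  proof
    fix d assume "d \<in> ?d"
    then have "d ^ k \<noteq> 0" by auto
    then show "finite (?R d)" using finite_residues[of "d ^ k"] by simp
  qed
  have "{d. lead_coeff d = 1 \<and> d dvd D} = ?d" using C(3,4) by (auto intro: dvd_trans)
  then have "(\<Sum>d | lead_coeff d = 1 \<and> d dvd D. eta \<psi> k G d)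
      = (\<Sum>d\<in>?d. \<Sum>R\<in>?R d. add_char \<psi> G (C ^ k) ((C div d) ^ k * R))"
    by (simp add: eta_def char)
  also have "\<dots> = (\<Sum>(d, R)\<in>Sigma ?d ?R. add_char \<psi> G (C ^ k) ((C div d) ^ k * R))"
    by (rule sum.Sigma[OF fin finR])
  also have "\<dots> = (\<Sum>R\<in>range (\<lambda>A. A mod C ^ k). add_char \<psi> G (C ^ k) R)"
    using sum.reindex_bij_betw[OF residues_decomposition[OF C(1) k], of "add_char \<psi> G (C ^ k)"]
    by (simp add: case_prod_unfold)
  also have "\<dots> = (if C ^ k dvd G then of_nat (poly_abs (C ^ k)) else 0)"
    using C0 by (intro complete_add_char_sum nz add nontrivial) auto
  also have "C ^ k dvd G \<longleftrightarrow> D ^ k dvd G"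
    using C(3,4)[THEN dvd_power_same, of k] by (metis dvd_trans)
  also have "poly_abs (C ^ k) = poly_abs D ^ k"
    using C C0 D by (simp add: poly_abs_power) (simp add: poly_abs_def)
  finally show ?thesis by simp
qed

section \<open>Recovering a function from its divisor sums, and the theorem\<close>

lemma divisor_sums_determine:
  fixes f g :: "'a::{finite,field} poly \<Rightarrow> 'b::ab_group_add"
  assumes eq: "\<And>D. lead_coeff D = 1 \<Longrightarrow> D dvd H \<Longrightarrow>
      (\<Sum>d | lead_coeff d = 1 \<and> d dvd D. f d) = (\<Sum>d | lead_coeff d = 1 \<and> d dvd D. g d)"
    and D: "lead_coeff D = 1" "D dvd H"
  shows "f D = g D"
  using D
\<comment> \<open>Monic divisors of \<open>D\<close> other than \<open>D\<close> have smaller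
  degree, so induction settles their terms and only the term at \<open>D\<close> remains. No Moebius
  function is involved.\<close>
proof (induction D rule: measure_induct_rule[of degree])
  case (less D)
  let ?d = "{d. lead_coeff d = 1 \<and> d dvd D}"
  have D0: "D \<noteq> 0" using less.prems by auto
  have fin: "finite ?d" using finite_monic_divisors[OF D0] .
  have mem: "D \<in> ?d" using less.prems by simp
  have "f d = g d" if "d \<in> ?d - {D}" for d
  proof (rule less.IH)
    have d: "lead_coeff d = 1" "d dvd D" "d \<noteq> D" using that by auto
    then obtain e where e: "D = d * e" by blast
    have "lead_coeff e = 1" using less.prems d e by (simp add: lead_coeff_mult)
    then have "degree e \<noteq> 0" using monic_degree_0_iff e d by fastforce
    then show "degree d < degree D" using e D0 by (auto simp: degree_mult_eq)
    show "lead_coeff d = 1" using d by simp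
    show "d dvd H" using d less.prems dvd_trans by blast
  qed
  then have "sum f (?d - {D}) = sum g (?d - {D})" by (rule sum.cong[OF refl])
  then show ?case
    using eq[OF less.prems] sum.remove[OF fin mem, of f] sum.remove[OF fin mem, of g] by simp
qed

theorem theorem4p1:
  fixes \<psi> :: "'a::{finite,field} \<Rightarrow> complex"
    and k :: nat
    and H D1 D2 :: "'a poly"
  assumes "\<And>x. \<psi> x \<noteq> 0"
    and "\<And>x y. \<psi> (x + y) = \<psi> x * \<psi> y"
    and "\<exists>x. \<psi> x \<noteq> 1"
    and "k \<ge> 1"
    and "H \<noteq> 0"
    and "lead_coeff D1 = 1" and "D1 dvd H"
    and "lead_coeff D2 = 1" and "D2 dvd H"
  shows "(\<Sum>D | lead_coeff D = 1 \<and> D dvd H. eta \<psi> k ((H div D) ^ k) D1 * eta \<psi> k ((H div D2) ^ k) D)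
    = (if D1 = D2 then of_nat (poly_abs H) ^ k else 0)"
proof -
  note eta_sum = eta_divisor_sum[OF assms(1-4)]
  note power_dvd = poly_power_dvd_power_iff[OF _ assms(4)]
  \<comment> \<open>With \<open>D2\<close> fixed, the sum becomes a function of the first divisor
    alone, and the inversion runs in that variable.\<close>
  let ?T = "\<lambda>E. \<Sum>D | lead_coeff D = 1 \<and> D dvd H. eta \<psi> k ((H div D) ^ k) E * eta \<psi> k ((H div D2) ^ k) D"
  have "?T D1 = (if D1 = D2 then of_nat (poly_abs H) ^ k else 0)"
  proof (rule divisor_sums_determine[where H = H and f = ?T
        and g = "\<lambda>E. if E = D2 then of_nat (poly_abs H) ^ k else 0"])
    fix E :: "'a poly" assume E: "lead_coeff E = 1" "E dvd H"
    have nz: "E \<noteq> 0" "H div E \<noteq> 0" "H div D2 \<noteq> 0" "D2 \<noteq> 0"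
      using E assms by (auto simp: dvd_div_eq_0_iff)
    have swap: "A dvd H div B \<longleftrightarrow> A * B dvd H" if "B dvd H" "B \<noteq> 0" for A B :: "'a poly"
      using that by (metis dvd_div_mult_self dvd_mult_cancel_right)
    \<comment> \<open>Both conditions amount to \<open>E * D dvd H\<close>. The restricted sum thus
      runs over all monic divisors of \<open>H div E\<close>, and \<open>eta_sum\<close> applies a
      second time.\<close>
    have set: "{D. lead_coeff D = 1 \<and> D dvd H \<and> E dvd H div D} = {D. lead_coeff D = 1 \<and> D dvd H div E}"
    proof (intro Collect_cong conj_cong refl)
      fix D :: "'a poly" assume "lead_coeff D = 1"
      then have "D \<noteq> 0" by auto
      then have "D dvd H \<and> E dvd H div D \<longleftrightarrow> E * D dvd H"
        using swap[of D E] by (metis dvd_mult_right)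
      then show "D dvd H \<and> E dvd H div D \<longleftrightarrow> D dvd H div E"
        using swap[OF E(2) nz(1), of D] by (simp add: mult.commute)
    qed
    have "(\<Sum>d | lead_coeff d = 1 \<and> d dvd E. ?T d)
      = (\<Sum>D | lead_coeff D = 1 \<and> D dvd H.
          (\<Sum>d | lead_coeff d = 1 \<and> d dvd E. eta \<psi> k ((H div D) ^ k) d) * eta \<psi> k ((H div D2) ^ k) D)"
      by (subst sum.swap) (simp add: sum_distrib_right)
    also have "\<dots> = (\<Sum>D | lead_coeff D = 1 \<and> D dvd H.
        if E dvd H div D then of_nat (poly_abs E) ^ k * eta \<psi> k ((H div D2) ^ k) D else 0)"
      by (intro sum.cong refl) (simp add: eta_sum nz power_dvd)
    also have "\<dots> = (\<Sum>D | lead_coeff D = 1 \<and> D dvd H \<and> E dvd H div D.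
        of_nat (poly_abs E) ^ k * eta \<psi> k ((H div D2) ^ k) D)"
      using finite_monic_divisors[OF assms(5)] by (simp add: sum.inter_filter[symmetric] conj_assoc)
    also have "\<dots> = of_nat (poly_abs E) ^ k *
        (\<Sum>D | lead_coeff D = 1 \<and> D dvd H div E. eta \<psi> k ((H div D2) ^ k) D)"
      by (simp add: set sum_distrib_left)
    also have "\<dots> = (if H div E dvd H div D2 then of_nat (poly_abs E * poly_abs (H div E)) ^ k else 0)"
      by (simp add: eta_sum nz power_dvd power_mult_distrib)
    also have "poly_abs E * poly_abs (H div E) = poly_abs H"
      using E by (simp add: poly_abs_mult[symmetric])
    \<comment> \<open>Passing to complementary divisors reverses divisibility.\<close>
    also have "H div E dvd H div D2 \<longleftrightarrow> D2 dvd E"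
    proof -
      have "H div E dvd H div D2 \<longleftrightarrow> H div E * D2 dvd H div E * E"
        using swap[OF assms(9) nz(4)] E by simp
      then show ?thesis using nz by simp
    qed
    \<comment> \<open>The monic \<open>D2\<close> occurs among the indices \<open>d\<close> exactly
      when it divides \<open>E\<close>.\<close>
    also have "(if D2 dvd E then of_nat (poly_abs H) ^ k else 0)
      = (\<Sum>d | lead_coeff d = 1 \<and> d dvd E. if d = D2 then of_nat (poly_abs H) ^ k else (0::complex))"
      using finite_monic_divisors[OF nz(1)] assms(8) by (simp add: sum.delta')
    finally show "(\<Sum>d | lead_coeff d = 1 \<and> d dvd E. ?T d)
      = (\<Sum>d | lead_coeff d = 1 \<and> d dvd E. if d = D2 then of_nat (poly_abs H) ^ k else 0)" .
  qed (use assms in auto)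
  then show ?thesis .
qed

end
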